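(* Let $n\in\mathbb{N}$, $\alpha\in\mathbb{N}_0^n$, and let $T:\mathbb{R}_{2\alpha}[x_1,\ldots,x_n]\to\mathbb{R}[x_1,\ldots,x_n]$ be a linear operator. Then $$\begin{aligned}T(\overline{POS}(n)_{2\alpha})\subseteq\overline{POS}(n)&\Leftrightarrow T_{\mathbf{y}}(\overline{POS}(n)_{2\alpha})\subseteq\overline{POS}(n)\ \text{ for all } \mathbf{y}\in\mathbb{R}^n\\&\Leftrightarrow\langle p_{\mathbf{y},2\alpha},f\rangle\ge0\ \text{ for all } \mathbf{y}\in\mathbb{R}^n,\ f\in\overline{POS}(n)_{2\alpha}\end{aligned}$$ (i.e., $p_{\mathbf{y},2\alpha}\in\overline{POS}(n)_{2\alpha}^*$ for all $\mathbf{y}\in\mathbb{R}^n$), and $$\begin{aligned}T(POS(n)_{2\alpha})\subseteq POS(n)&\Leftrightarrow T_{\mathbf{y}}(POS(n)_{2\alpha})\subseteq POS(n)\ \text{ for all } \mathbf{y}\in\mathbb{R}^n\\&\Leftrightarrow\langle p_{\mathbf{y},2\alpha},f\rangle>0\ \text{ for all } \mathbf{y}\in\mathbb{R}^n,\ f\in POS(n)_{2\alpha}.\end{aligned}$$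
   Context: $\mathbb{N}_0$ is the set of non-negative integers. For $\alpha=(\alpha_1,\ldots,\alpha_n)\in\mathbb{N}_0^n$ and $\mathbf{x}=(x_1,\ldots,x_n)$: $\mathbf{x}^\alpha=x_1^{\alpha_1}\cdots x_n^{\alpha_n}$, $\alpha!=\alpha_1!\cdots\alpha_n!$, $2\alpha=(2\alpha_1,\ldots,2\alpha_n)$, $\partial^\alpha=\partial_{x_1}^{\alpha_1}\cdots\partial_{x_n}^{\alpha_n}$ with $\partial_{x_i}=\partial/\partial x_i$; $\beta\le\alpha$ means $\beta_i\le\alpha_i$ for all $i$. $\mathbb{R}_\alpha[x_1,\ldots,x_n]=\{p\in\mathbb{R}[x_1,\ldots,x_n]:\deg_{x_i}(p)\le\alpha_i,\ 1\le i\le n\}$. $POS(n)$ (respectively $\overline{POS}(n)$) is the set of $p\in\mathbb{R}[x_1,\ldots,x_n]$ with $p(\mathbf{x})>0$ (respectively $p(\mathbf{x})\ge0$) for all $\mathbf{x}\in\mathbb{R}^n$. For $V\in\{POS(n),\overline{POS}(n)\}$, $V_\alpha=V\cap\mathbb{R}_\alpha[x_1,\ldots,x_n]$. A linear operator $T:\mathbb{R}_{2\alpha}[x_1,\ldots,x_n]\to\mathbb{R}[x_1,\ldots,x_n]$ is uniquely written as $T=\sum_{\beta\le2\alpha}q_\beta(\mathbf{x})\partial^\beta$ with $q_\beta\in\mathbb{R}[x_1,\ldots,x_n]$. For fixed $\mathbf{y}\in\mathbb{R}^n$ define $$T_{\mathbf{y}}=\sum_{\beta\le2\alpha}q_\beta(\mathbf{y})\partial^\beta:\mathbb{R}_{2\alpha}[x_1,\ldots,x_n]\to\mathbb{R}[x_1,\ldots,x_n],\qquad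 p_{\mathbf{y},2\alpha}(\mathbf{x})=\sum_{\beta\le2\alpha}q_\beta(\mathbf{y})\mathbf{x}^\beta.$$ The inner product on $\mathbb{R}[x_1,\ldots,x_n]$ is the Fischer-Fock one: $\langle\sum_\alpha a_\alpha\mathbf{x}^\alpha,\sum_\alpha b_\alpha\mathbf{x}^\alpha\rangle=\sum_\alpha\alpha!\,a_\alpha b_\alpha$. For a cone $K\subseteq\mathbb{R}[x_1,\ldots,x_n]$, $K^*=\{f\in\mathbb{R}[x_1,\ldots,x_n]:\langle f,g\rangle\ge0 \text{ for all } g\in K\}$. *)

theory Defs
  imports "HOL-Analysis.Analysis" "HOL-Analysis.Finite_Function_Topology"
begin

text \<open>
  A finite index type \<open>'n\<close> plays the role of \<open>{1, \<dots>, n}\<close>. Multi-indices are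
  finitely supported functions \<open>'n \<Rightarrow>\<^sub>0 nat\<close> (all functions, as \<open>'n\<close> is finite), and the
  polynomial ring is the monoid algebra of \<open>'n \<Rightarrow>\<^sub>0 nat\<close> with its convolution product.
  The order that the library puts on \<open>\<Rightarrow>\<^sub>0\<close> is lexicographic, so the componentwise
  order is spelled out.
\<close>

abbreviation lookup :: "('a \<Rightarrow>\<^sub>0 'b::zero) \<Rightarrow> 'a \<Rightarrow> 'b" where
  "lookup \<equiv> Poly_Mapping.lookup"

abbreviation keys :: "('a \<Rightarrow>\<^sub>0 'b::zero) \<Rightarrow> 'a set" where
  "keys \<equiv> Poly_Mapping.keys"

type_synonym 'n midx = "'n \<Rightarrow>\<^sub>0 nat"
type_synonym 'n rpoly = "('n \<Rightarrow>\<^sub>0 nat) \<Rightarrow>\<^sub>0 real"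

definition midx_le :: "'n midx \<Rightarrow> 'n midx \<Rightarrow> bool" (infix \<open>\<unlhd>\<close> 50) where
  "\<beta> \<unlhd> \<alpha> \<longleftrightarrow> (\<forall>i. lookup \<beta> i \<le> lookup \<alpha> i)"

definition midx_fact :: "'n::finite midx \<Rightarrow> real" where
  "midx_fact \<beta> = (\<Prod>i\<in>UNIV. fact (lookup \<beta> i))"

definition rpoly_eval :: "'n::finite rpoly \<Rightarrow> real ^ 'n \<Rightarrow> real" where
  "rpoly_eval p x = (\<Sum>\<beta>\<in>keys p. lookup p \<beta> * (\<Prod>i\<in>UNIV. (x $ i) ^ lookup \<beta> i))"

definition degree_in :: "'n \<Rightarrow> 'n rpoly \<Rightarrow> nat" where
  "degree_in i p = Max (insert 0 ((\<lambda>\<beta>. lookup \<beta> i) ` keys p))"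

definition rpoly_space :: "'n midx \<Rightarrow> 'n rpoly set" where
  "rpoly_space \<alpha> = {p. \<forall>i. degree_in i p \<le> lookup \<alpha> i}"

definition POS :: "'n::finite rpoly set" where
  "POS = {p. \<forall>x. rpoly_eval p x > 0}"

definition POS_bar :: "'n::finite rpoly set" where
  "POS_bar = {p. \<forall>x. rpoly_eval p x \<ge> 0}"

text \<open>
  In \<open>partial_deriv\<close>, subtraction on exponents is truncated, but a truncated term has
  coefficient \<open>0\<close>. The operators folded over in \<open>midx_deriv\<close> commute (lemma
  \<open>partial_deriv_fold_commute\<close>), so the order of the fold is irrelevant.
\<close>

definition partial_deriv :: "'n \<Rightarrow> 'n rpoly \<Rightarrow> 'n rpoly" where
  "partial_deriv i p =
     (\<Sum>\<beta>\<in>keys p. Poly_Mapping.single (\<beta> - Poly_Mapping.single i 1)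
        (real (lookup \<beta> i) * lookup p \<beta>))"

definition midx_deriv :: "'n::finite midx \<Rightarrow> 'n rpoly \<Rightarrow> 'n rpoly" where
  "midx_deriv \<beta> p = Finite_Set.fold (\<lambda>i. partial_deriv i ^^ lookup \<beta> i) p UNIV"

text \<open>Operators on \<open>rpoly_space \<alpha>\<close> are total functions whose values outside are ignored.\<close>

definition linear_operator_on :: "'n rpoly set \<Rightarrow> ('n rpoly \<Rightarrow> 'n rpoly) \<Rightarrow> bool" where
  "linear_operator_on V T \<longleftrightarrow>
     (\<forall>p\<in>V. \<forall>q\<in>V. T (p + q) = T p + T q) \<and> (\<forall>c. \<forall>p\<in>V. T (c *\<^sub>R p) = c *\<^sub>R T p)"

definition represents_operator ::
  "'n::finite midx \<Rightarrow> ('n rpoly \<Rightarrow> 'n rpoly) \<Rightarrow> ('n midx \<Rightarrow> 'n rpoly) \<Rightarrow> bool" where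
  "represents_operator \<gamma> T q \<longleftrightarrow>
     (\<forall>\<beta>. \<not> \<beta> \<unlhd> \<gamma> \<longrightarrow> q \<beta> = 0) \<and>
     (\<forall>p\<in>rpoly_space \<gamma>. T p = (\<Sum>\<beta> | \<beta> \<unlhd> \<gamma>. q \<beta> * midx_deriv \<beta> p))"

text \<open>
  The coefficients \<open>q\<^sub>\<beta>\<close> of a linear operator on \<open>rpoly_space \<gamma>\<close>; existence and uniqueness
  are lemma \<open>represents_operator_ex1\<close>.
\<close>

definition operator_coeff ::
  "'n::finite midx \<Rightarrow> ('n rpoly \<Rightarrow> 'n rpoly) \<Rightarrow> 'n midx \<Rightarrow> 'n rpoly" where
  "operator_coeff \<gamma> T = (THE q. represents_operator \<gamma> T q)"

definition operator_at ::
  "'n::finite midx \<Rightarrow> ('n rpoly \<Rightarrow> 'n rpoly) \<Rightarrow> real ^ 'n \<Rightarrow> 'n rpoly \<Rightarrow> 'n rpoly" where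
  "operator_at \<gamma> T y p =
     (\<Sum>\<beta> | \<beta> \<unlhd> \<gamma>. rpoly_eval (operator_coeff \<gamma> T \<beta>) y *\<^sub>R midx_deriv \<beta> p)"

definition symbol_at ::
  "'n::finite midx \<Rightarrow> ('n rpoly \<Rightarrow> 'n rpoly) \<Rightarrow> real ^ 'n \<Rightarrow> 'n rpoly" where
  "symbol_at \<gamma> T y =
     (\<Sum>\<beta> | \<beta> \<unlhd> \<gamma>. Poly_Mapping.single \<beta> (rpoly_eval (operator_coeff \<gamma> T \<beta>) y))"

definition fischer_inner :: "'n::finite rpoly \<Rightarrow> 'n rpoly \<Rightarrow> real" where
  "fischer_inner f g = (\<Sum>\<beta>\<in>keys f \<union> keys g. midx_fact \<beta> * lookup f \<beta> * lookup g \<beta>)"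

definition dual_cone :: "'n::finite rpoly set \<Rightarrow> 'n rpoly set" where
  "dual_cone K = {f. \<forall>g\<in>K. fischer_inner f g \<ge> 0}"


subsection \<open>Well-definedness\<close>

lemma finite_midx_le: "finite {\<beta>::'n::finite midx. \<beta> \<unlhd> \<gamma>}"
proof -
  have "lookup ` {\<beta>. \<beta> \<unlhd> \<gamma>} \<subseteq> (\<Pi>\<^sub>E i\<in>UNIV. {..lookup \<gamma> i})"
    by (auto simp: midx_le_def)
  moreover have "finite (\<Pi>\<^sub>E i\<in>(UNIV::'n set). {..lookup \<gamma> i})"
    by (intro finite_PiE) auto
  ultimately have "finite (lookup ` {\<beta>. \<beta> \<unlhd> \<gamma>})"
    by (rule finite_subset)
  then show ?thesis
    by (rule finite_imageD) (auto simp: inj_on_def intro: poly_mapping_eqI)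
qed

lemma lookup_scaleR_rpoly: "lookup (c *\<^sub>R p) \<beta> = c * lookup p \<beta>" for p :: "'n rpoly"
proof -
  have "finite {\<beta>. c * lookup p \<beta> \<noteq> 0}"
    by (rule finite_subset[of _ "keys p"]) (auto simp: in_keys_iff)
  then show ?thesis
    by (simp add: scaleR_poly_mapping_def)
qed

lemma lookup_partial_deriv:
  "lookup (partial_deriv i p) \<beta> =
     (real (lookup \<beta> i) + 1) * lookup p (\<beta> + Poly_Mapping.single i 1)"
proof -
  let ?e = "Poly_Mapping.single i (1::nat)"
  have eq: "(real (lookup \<gamma> i) * lookup p \<gamma> when \<gamma> - ?e = \<beta>) =
      (if \<gamma> = \<beta> + ?e then real (lookup \<gamma> i) * lookup p \<gamma> else 0)" for \<gamma>
  proof (cases "lookup \<gamma> i = 0")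
    case True
    then have "\<gamma> \<noteq> \<beta> + ?e" by (auto simp: lookup_add)
    with True show ?thesis by (simp add: when_def)
  next
    case False
    have "\<gamma> - ?e = \<beta> \<longleftrightarrow> \<gamma> = \<beta> + ?e"
    proof
      assume *: "\<gamma> - ?e = \<beta>"
      show "\<gamma> = \<beta> + ?e"
        by (rule poly_mapping_eqI)
          (use False in \<open>auto simp: *[symmetric] lookup_add lookup_minus lookup_single when_def\<close>)
    qed simp
    then show ?thesis by (simp add: when_def)
  qed
  have "lookup (partial_deriv i p) \<beta> =
      (\<Sum>\<gamma>\<in>keys p. if \<gamma> = \<beta> + ?e then real (lookup \<gamma> i) * lookup p \<gamma> else 0)"
    unfolding partial_deriv_def by (simp only: lookup_sum lookup_single eq)
  also have "\<dots> = real (lookup (\<beta> + ?e) i) * lookup p (\<beta> + ?e)"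
    by (subst sum.delta) (auto simp: in_keys_iff)
  finally show ?thesis
    by (simp add: lookup_add)
qed

lemma lookup_partial_deriv_funpow:
  "lookup ((partial_deriv i ^^ k) p) \<beta> =
     pochhammer (real (lookup \<beta> i) + 1) k * lookup p (\<beta> + Poly_Mapping.single i k)"
proof (induction k arbitrary: \<beta>)
  case (Suc k)
  have "\<beta> + Poly_Mapping.single i 1 + Poly_Mapping.single i k =
      \<beta> + Poly_Mapping.single i (Suc k)"
    by (simp add: add.assoc flip: single_add)
  then show ?case
    by (simp add: lookup_partial_deriv Suc.IH pochhammer_rec lookup_add ac_simps)
qed simp

lemma partial_deriv_fold_commute: "comp_fun_commute (\<lambda>i. partial_deriv i ^^ k i)"
proof
  fix i j
  show "(partial_deriv j ^^ k j) \<circ> (partial_deriv i ^^ k i) =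
      (partial_deriv i ^^ k i) \<circ> (partial_deriv j ^^ k j)"
  proof (cases "i = j")
    case False
    then show ?thesis
      by (intro ext poly_mapping_eqI)
        (simp add: lookup_partial_deriv_funpow lookup_add lookup_single_not_eq ac_simps)
  qed simp
qed

lemma lookup_midx_deriv:
  "lookup (midx_deriv \<beta> p) \<gamma> =
     (\<Prod>i\<in>UNIV. pochhammer (real (lookup \<gamma> i) + 1) (lookup \<beta> i)) * lookup p (\<gamma> + \<beta>)"
proof -
  interpret comp_fun_commute "\<lambda>i. partial_deriv i ^^ lookup \<beta> i"
    by (rule partial_deriv_fold_commute)
  have *: "lookup (Finite_Set.fold (\<lambda>i. partial_deriv i ^^ lookup \<beta> i) p A) \<gamma> =
      (\<Prod>i\<in>A. pochhammer (real (lookup \<gamma> i) + 1) (lookup \<beta> i)) *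
      lookup p (\<gamma> + (\<Sum>i\<in>A. Poly_Mapping.single i (lookup \<beta> i)))" if "finite A" for A \<gamma>
    using that
  proof (induction A arbitrary: \<gamma> rule: finite_induct)
    case (insert a A)
    have "lookup (\<gamma> + Poly_Mapping.single a (lookup \<beta> a)) i = lookup \<gamma> i" if "i \<in> A" for i
      using that insert.hyps by (auto simp: lookup_add lookup_single when_def)
    then show ?case
      using insert by (simp add: lookup_partial_deriv_funpow ac_simps)
  qed simp
  have "(\<Sum>i\<in>UNIV. Poly_Mapping.single i (lookup \<beta> i)) = \<beta>"
    by (rule poly_mapping_eqI) (simp add: lookup_sum lookup_single when_def)
  then show ?thesis
    using *[OF finite, of UNIV \<gamma>] by (simp add: midx_deriv_def)
qed

lemma rpoly_space_iff: "p \<in> rpoly_space \<gamma> \<longleftrightarrow> (\<forall>\<beta>\<in>keys p. \<beta> \<unlhd> \<gamma>)"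
  by (auto simp: rpoly_space_def degree_in_def midx_le_def)

lemma midx_deriv_add: "midx_deriv \<beta> (p + q) = midx_deriv \<beta> p + midx_deriv \<beta> q"
  by (rule poly_mapping_eqI) (simp add: lookup_midx_deriv lookup_add algebra_simps)

lemma midx_deriv_scaleR: "midx_deriv \<beta> (c *\<^sub>R p) = c *\<^sub>R midx_deriv \<beta> p"
  by (rule poly_mapping_eqI) (simp add: lookup_midx_deriv lookup_scaleR_rpoly algebra_simps)

lemma midx_deriv_monom_eq_0:
  assumes "\<not> \<beta> \<unlhd> \<gamma>"
  shows "midx_deriv \<beta> (Poly_Mapping.single \<gamma> 1) = 0"
proof (rule poly_mapping_eqI)
  fix \<delta>
  have "\<gamma> \<noteq> \<delta> + \<beta>"
    using assms by (auto simp: midx_le_def lookup_add)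
  then show "lookup (midx_deriv \<beta> (Poly_Mapping.single \<gamma> 1)) \<delta> = lookup 0 \<delta>"
    by (simp add: lookup_midx_deriv lookup_single)
qed

lemma midx_deriv_monom_self:
  "midx_deriv \<gamma> (Poly_Mapping.single \<gamma> 1) = Poly_Mapping.single 0 (midx_fact \<gamma>)"
  by (rule poly_mapping_eqI)
    (auto simp: lookup_midx_deriv lookup_single when_def midx_fact_def pochhammer_fact)

definition midx_deg :: "'n::finite midx \<Rightarrow> nat" where
  "midx_deg \<beta> = (\<Sum>i\<in>UNIV. lookup \<beta> i)"

lemma midx_le_deg_less:
  assumes "\<beta> \<unlhd> \<gamma>" "\<beta> \<noteq> \<gamma>"
  shows "midx_deg \<beta> < midx_deg \<gamma>"
proof -
  obtain i where "lookup \<beta> i \<noteq> lookup \<gamma> i"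
    using assms(2) by (meson poly_mapping_eqI)
  then show ?thesis
    using assms(1) unfolding midx_deg_def midx_le_def
    by (intro sum_strict_mono_ex1) (auto simp: le_less)
qed

lemma operator_sum_monom:
  assumes "\<gamma> \<unlhd> \<alpha>"
  shows "(\<Sum>\<beta> | \<beta> \<unlhd> \<alpha>. q \<beta> * midx_deriv \<beta> (Poly_Mapping.single \<gamma> 1)) =
     midx_fact \<gamma> *\<^sub>R q \<gamma> +
     (\<Sum>\<beta> | \<beta> \<unlhd> \<alpha> \<and> midx_deg \<beta> < midx_deg \<gamma>. q \<beta> * midx_deriv \<beta> (Poly_Mapping.single \<gamma> 1))"
proof -
  have "q \<gamma> * Poly_Mapping.single 0 (midx_fact \<gamma>) = midx_fact \<gamma> *\<^sub>R q \<gamma>"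
    by (rule poly_mapping_eqI)
      (simp add: mult.commute[of "q \<gamma>"] lookup_scaleR_rpoly map.rep_eq when_def
        flip: mult_map_scale_conv_mult)
  moreover have "(\<Sum>\<beta> | \<beta> \<unlhd> \<alpha>. q \<beta> * midx_deriv \<beta> (Poly_Mapping.single \<gamma> 1)) =
      (\<Sum>\<beta>\<in>insert \<gamma> {\<beta>. \<beta> \<unlhd> \<alpha> \<and> midx_deg \<beta> < midx_deg \<gamma>}.
         q \<beta> * midx_deriv \<beta> (Poly_Mapping.single \<gamma> 1))"
  proof (rule sum.mono_neutral_right[OF finite_midx_le], goal_cases)
    case 2
    show ?case
    proof
      fix \<beta> assume "\<beta> \<in> {\<beta>. \<beta> \<unlhd> \<alpha>} - insert \<gamma> {\<beta>. \<beta> \<unlhd> \<alpha> \<and> midx_deg \<beta> < midx_deg \<gamma>}"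
      then have "\<not> \<beta> \<unlhd> \<gamma>"
        using midx_le_deg_less by blast
      then show "q \<beta> * midx_deriv \<beta> (Poly_Mapping.single \<gamma> 1) = 0"
        by (simp add: midx_deriv_monom_eq_0)
    qed
  qed (use assms in auto)
  moreover have "finite {\<beta>. \<beta> \<unlhd> \<alpha> \<and> midx_deg \<beta> < midx_deg \<gamma>}"
    using finite_midx_le by (rule finite_subset[rotated]) auto
  ultimately show ?thesis
    by (simp add: midx_deriv_monom_self)
qed

lemma midx_fact_pos: "midx_fact \<gamma> > 0"
  by (simp add: midx_fact_def prod_pos)

lemma represents_operator_iff_monom:
  assumes "linear_operator_on (rpoly_space \<alpha>) T"
  shows "represents_operator \<alpha> T q \<longleftrightarrow>
    (\<forall>\<beta>. \<not> \<beta> \<unlhd> \<alpha> \<longrightarrow> q \<beta> = 0) \<and>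
    (\<forall>\<gamma>. \<gamma> \<unlhd> \<alpha> \<longrightarrow> T (Poly_Mapping.single \<gamma> 1) =
       (\<Sum>\<beta> | \<beta> \<unlhd> \<alpha>. q \<beta> * midx_deriv \<beta> (Poly_Mapping.single \<gamma> 1)))"
proof -
  let ?S = "\<lambda>p. \<Sum>\<beta> | \<beta> \<unlhd> \<alpha>. q \<beta> * midx_deriv \<beta> p"
  have mult_scaleR: "r * (c *\<^sub>R s) = c *\<^sub>R (r * s)" for c and r s :: "'a rpoly"
  proof -
    have *: "c *\<^sub>R t = Poly_Mapping.single 0 c * t" for t :: "'a rpoly"
      by (rule poly_mapping_eqI)
        (simp add: lookup_scaleR_rpoly map.rep_eq when_def flip: mult_map_scale_conv_mult)
    show ?thesis
      by (simp add: * ac_simps)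
  qed
  have S_add: "?S (p + r) = ?S p + ?S r" for p r
    by (simp add: midx_deriv_add distrib_left sum.distrib)
  have S_scale: "?S (c *\<^sub>R p) = c *\<^sub>R ?S p" for c p
    by (simp add: midx_deriv_scaleR mult_scaleR scaleR_sum_right)
  have T_add: "T (p + r) = T p + T r" if "p \<in> rpoly_space \<alpha>" "r \<in> rpoly_space \<alpha>" for p r
    using that assms by (auto simp: linear_operator_on_def)
  have T_scale: "T (c *\<^sub>R p) = c *\<^sub>R T p" if "p \<in> rpoly_space \<alpha>" for c p
    using that assms by (auto simp: linear_operator_on_def)
  have monom: "c *\<^sub>R Poly_Mapping.single \<gamma> 1 = (Poly_Mapping.single \<gamma> c :: 'a rpoly)" for c \<gamma>
    by (rule poly_mapping_eqI) (simp add: lookup_scaleR_rpoly lookup_single when_def)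
  have zero: "T 0 = 0"
    using T_scale[of 0 0] by (simp add: rpoly_space_iff)
  have "T p = ?S p"
    if *: "\<And>\<gamma>. \<gamma> \<unlhd> \<alpha> \<Longrightarrow> T (Poly_Mapping.single \<gamma> 1) = ?S (Poly_Mapping.single \<gamma> 1)"
      and "p \<in> rpoly_space \<alpha>" for p
    using that(2)
  proof (induction p rule: update_induct)
    case const
    then show ?case using S_scale[of 0 0] zero by simp
  next
    case (update p \<gamma> c)
    have upd: "Poly_Mapping.update \<gamma> c p = p + c *\<^sub>R Poly_Mapping.single \<gamma> 1"
      by (rule poly_mapping_eqI)
        (use update.hyps in \<open>auto simp: monom lookup_update lookup_add lookup_single in_keys_iff\<close>)
    have p: "p \<in> rpoly_space \<alpha>" and g: "\<gamma> \<unlhd> \<alpha>"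
      using update.prems update.hyps by (auto simp: rpoly_space_iff keys_update)
    have m: "d *\<^sub>R Poly_Mapping.single \<gamma> 1 \<in> rpoly_space \<alpha>" for d
      using g by (auto simp: monom rpoly_space_iff)
    show ?case
      using m[of 1] unfolding upd
      by (simp only: T_add[OF p m] T_scale S_add S_scale update.IH[OF p] *[OF g] scaleR_one)
  qed
  then show ?thesis
    by (auto simp: represents_operator_def rpoly_space_iff)
qed

lemma represents_operator_ex1:
  assumes "linear_operator_on (rpoly_space \<alpha>) T"
  shows "\<exists>!q. represents_operator \<alpha> T q"
proof -
  let ?m = "\<lambda>\<gamma>. Poly_Mapping.single \<gamma> 1 :: 'a rpoly"
  let ?R = "\<lambda>q \<gamma>. \<Sum>\<beta> | \<beta> \<unlhd> \<alpha> \<and> midx_deg \<beta> < midx_deg \<gamma>. q \<beta> * midx_deriv \<beta> (?m \<gamma>)"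
  have char: "represents_operator \<alpha> T q \<longleftrightarrow> (\<forall>\<beta>. \<not> \<beta> \<unlhd> \<alpha> \<longrightarrow> q \<beta> = 0) \<and>
      (\<forall>\<gamma>. \<gamma> \<unlhd> \<alpha> \<longrightarrow> T (?m \<gamma>) = midx_fact \<gamma> *\<^sub>R q \<gamma> + ?R q \<gamma>)" for q
    unfolding represents_operator_iff_monom[OF assms] by (auto simp: operator_sum_monom)
  have "\<exists>q. (\<forall>\<beta>. \<not> \<beta> \<unlhd> \<alpha> \<longrightarrow> q \<beta> = 0) \<and>
      (\<forall>\<gamma>. \<gamma> \<unlhd> \<alpha> \<and> midx_deg \<gamma> < N \<longrightarrow> T (?m \<gamma>) = midx_fact \<gamma> *\<^sub>R q \<gamma> + ?R q \<gamma>)" for N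
  proof (induction N)
    case 0
    show ?case by (intro exI[of _ "\<lambda>_. 0"]) simp
  next
    case (Suc N)
    then obtain q where q: "\<And>\<beta>. \<not> \<beta> \<unlhd> \<alpha> \<Longrightarrow> q \<beta> = 0"
      "\<And>\<gamma>. \<gamma> \<unlhd> \<alpha> \<Longrightarrow> midx_deg \<gamma> < N \<Longrightarrow> T (?m \<gamma>) = midx_fact \<gamma> *\<^sub>R q \<gamma> + ?R q \<gamma>"
      by blast
    define q' where "q' = (\<lambda>\<gamma>. if \<gamma> \<unlhd> \<alpha> \<and> midx_deg \<gamma> = N
      then inverse (midx_fact \<gamma>) *\<^sub>R (T (?m \<gamma>) - ?R q \<gamma>) else q \<gamma>)"
    have R: "?R q' \<gamma> = ?R q \<gamma>" if "midx_deg \<gamma> \<le> N" for \<gamma>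
      using that by (intro sum.cong) (auto simp: q'_def)
    have "T (?m \<gamma>) = midx_fact \<gamma> *\<^sub>R q' \<gamma> + ?R q' \<gamma>" if "\<gamma> \<unlhd> \<alpha>" "midx_deg \<gamma> < Suc N" for \<gamma>
    proof (cases "midx_deg \<gamma> = N")
      case True
      then show ?thesis
        using that midx_fact_pos[of \<gamma>] by (simp add: R) (simp add: q'_def)
    next
      case False
      then show ?thesis
        using that q(2)[of \<gamma>] by (simp add: R) (simp add: q'_def)
    qed
    moreover have "q' \<beta> = 0" if "\<not> \<beta> \<unlhd> \<alpha>" for \<beta>
      using that q(1) by (simp add: q'_def)
    ultimately show ?case by blast
  qed
  from this[of "Suc (midx_deg \<alpha>)"] obtain q where q: "\<And>\<beta>. \<not> \<beta> \<unlhd> \<alpha> \<Longrightarrow> q \<beta> = 0"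
    "\<And>\<gamma>. \<gamma> \<unlhd> \<alpha> \<Longrightarrow> midx_deg \<gamma> < Suc (midx_deg \<alpha>) \<Longrightarrow>
       T (?m \<gamma>) = midx_fact \<gamma> *\<^sub>R q \<gamma> + ?R q \<gamma>"
    by blast
  have "midx_deg \<gamma> < Suc (midx_deg \<alpha>)" if "\<gamma> \<unlhd> \<alpha>" for \<gamma>
    using midx_le_deg_less[OF that] by (cases "\<gamma> = \<alpha>") auto
  then have "represents_operator \<alpha> T q"
    using q by (simp add: char)
  moreover have "q1 = q2"
    if 1: "represents_operator \<alpha> T q1" and 2: "represents_operator \<alpha> T q2" for q1 q2
  proof
    fix \<gamma>
    show "q1 \<gamma> = q2 \<gamma>"
    proof (induction "midx_deg \<gamma>" arbitrary: \<gamma> rule: less_induct)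
      case less
      show ?case
      proof (cases "\<gamma> \<unlhd> \<alpha>")
        case True
        have R: "?R q1 \<gamma> = ?R q2 \<gamma>"
          by (intro sum.cong) (auto simp: less)
        have T1: "T (?m \<gamma>) = midx_fact \<gamma> *\<^sub>R q1 \<gamma> + ?R q1 \<gamma>"
          by (rule 1[unfolded char, THEN conjunct2, rule_format, OF True])
        have T2: "T (?m \<gamma>) = midx_fact \<gamma> *\<^sub>R q2 \<gamma> + ?R q2 \<gamma>"
          by (rule 2[unfolded char, THEN conjunct2, rule_format, OF True])
        have "midx_fact \<gamma> *\<^sub>R q1 \<gamma> = midx_fact \<gamma> *\<^sub>R q2 \<gamma>"
          by (rule add_right_imp_eq) (rule trans[OF T1[unfolded R, symmetric] T2])
        then show ?thesis
          using midx_fact_pos[of \<gamma>] by simp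
      next
        case False
        then show ?thesis
          using 1 2 by (simp add: represents_operator_def)
      qed
    qed
  qed
  ultimately show ?thesis by blast
qed

end

(* Write \<open>L\<^sub>y f = \<langle>p\<^sub>y, f\<rangle>\<close>. Taylor's formula gives \<open>(T\<^sub>y f)(x) = L\<^sub>y (f(\<cdot> + x))\<close>, and \<open>(T f)(y) = (T\<^sub>y f)(y)\<close>.
   All three conditions say that \<open>L\<^sub>y\<close> is nonnegative (positive) on the cone for every \<open>y\<close>, because
   translations map the cone onto itself and commute with the constant-coefficient operators \<open>T\<^sub>y\<close>. *)

theory Submission
  imports Defs
begin

section \<open>Evaluation respects sums, scalars and products\<close>

lemma rpoly_eval_superset:
  assumes "finite A" "keys p \<subseteq> A"
  shows "rpoly_eval p x = (\<Sum>\<beta>\<in>A. lookup p \<beta> * (\<Prod>i\<in>UNIV. (x $ i) ^ lookup \<beta> i))"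
  unfolding rpoly_eval_def
  by (rule sum.mono_neutral_left) (use assms in \<open>auto simp: in_keys_iff\<close>)

lemma rpoly_eval_0 [simp]: "rpoly_eval 0 x = 0"
  by (simp add: rpoly_eval_def)

lemma rpoly_eval_add: "rpoly_eval (p + q) x = rpoly_eval p x + rpoly_eval q x"
proof -
  \<comment> \<open>Cancellation can make this strict, so all three evaluations are summed over the
    union.\<close>
  have "keys (p + q) \<subseteq> keys p \<union> keys q"
    by (rule keys_add)
  then show ?thesis
    by (simp add: rpoly_eval_superset[of "keys p \<union> keys q"] lookup_add distrib_right sum.distrib)
qed

lemma rpoly_eval_sum: "rpoly_eval (\<Sum>a\<in>A. f a) x = (\<Sum>a\<in>A. rpoly_eval (f a) x)"
  by (induction A rule: infinite_finite_induct) (simp_all add: rpoly_eval_add)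

lemma rpoly_eval_single:
  "rpoly_eval (Poly_Mapping.single \<beta> c) x = c * (\<Prod>i\<in>UNIV. (x $ i) ^ lookup \<beta> i)"
  by (subst rpoly_eval_superset[of "{\<beta>}"]) auto

lemma rpoly_eval_scaleR: "rpoly_eval (c *\<^sub>R p) x = c * rpoly_eval p x"
proof -
  have "keys (c *\<^sub>R p) \<subseteq> keys p"
    by (auto simp: in_keys_iff lookup_scaleR_rpoly)
  then show ?thesis
    by (simp add: rpoly_eval_superset[of "keys p"] lookup_scaleR_rpoly sum_distrib_left mult.assoc)
qed

lemma rpoly_sum_monomials: "(\<Sum>\<beta>\<in>keys p. Poly_Mapping.single \<beta> (lookup p \<beta>)) = p"
  by (rule poly_mapping_eqI) (simp add: lookup_sum lookup_single when_def in_keys_iff)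

lemma rpoly_eval_mult: "rpoly_eval (p * q) x = rpoly_eval p x * rpoly_eval q x"
proof -
  \<comment> \<open>Splitting both factors into monomials reduces the convolution product to
    \<open>mult_single\<close>.\<close>
  have "p * q = (\<Sum>\<beta>\<in>keys p. Poly_Mapping.single \<beta> (lookup p \<beta>)) *
      (\<Sum>\<gamma>\<in>keys q. Poly_Mapping.single \<gamma> (lookup q \<gamma>))"
    by (simp only: rpoly_sum_monomials)
  also have "\<dots> = (\<Sum>\<beta>\<in>keys p. \<Sum>\<gamma>\<in>keys q. 
      Poly_Mapping.single (\<beta> + \<gamma>) (lookup p \<beta> * lookup q \<gamma>))"
    by (simp add: sum_product mult_single)
  finally show ?thesis
    by (simp add: rpoly_eval_sum rpoly_eval_single lookup_add power_add prod.distrib)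
      (simp add: rpoly_eval_def sum_product ac_simps)
qed

text \<open>Each falling factorial \<delta>!/(\<delta>-\<gamma>)! from differentiating a monomial is
  \<gamma>! times a product of binomials. That product vanishes unless \<gamma> \<unlhd> \<delta>,
  so the sum may run over all keys of p despite the truncated exponents.\<close>

lemma rpoly_eval_midx_deriv:
  "rpoly_eval (midx_deriv \<gamma> p) a = midx_fact \<gamma> *
     (\<Sum>\<delta>\<in>keys p. lookup p \<delta> *
       (\<Prod>i\<in>UNIV. real (lookup \<delta> i choose lookup \<gamma> i) * (a $ i) ^ (lookup \<delta> i - lookup \<gamma> i)))"
proof -
  let ?A = "{\<delta> \<in> keys p. \<gamma> \<unlhd> \<delta>}"
  have diff_add: "\<delta> - \<gamma> + \<gamma> = \<delta>" if "\<gamma> \<unlhd> \<delta>" for \<delta>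
    by (rule poly_mapping_eqI) (use that in \<open>simp add: midx_le_def lookup_add lookup_minus\<close>)
  have inj: "inj_on (\<lambda>\<delta>. \<delta> - \<gamma>) ?A"
    by (rule inj_on_inverseI[of _ "\<lambda>\<delta>. \<delta> + \<gamma>"]) (auto simp: diff_add)
  have keys: "keys (midx_deriv \<gamma> p) \<subseteq> (\<lambda>\<delta>. \<delta> - \<gamma>) ` ?A"
  proof
    fix \<beta> assume "\<beta> \<in> keys (midx_deriv \<gamma> p)"
    then have "\<beta> + \<gamma> \<in> ?A"
      by (auto simp: in_keys_iff lookup_midx_deriv midx_le_def lookup_add)
    moreover have "\<beta> = \<beta> + \<gamma> - \<gamma>" by simp
    ultimately show "\<beta> \<in> (\<lambda>\<delta>. \<delta> - \<gamma>) ` ?A" by blast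
  qed
  \<comment> \<open>The rising product from m-k+1 up to m is the falling factorial of m.\<close>
  have poch: "pochhammer (real m - real k + 1) k = fact k * real (m choose k)" if "k \<le> m" for m k
    using that by (simp add: binomial_gbinomial gbinomial_pochhammer' of_nat_diff)
  have "rpoly_eval (midx_deriv \<gamma> p) a = (\<Sum>\<delta>\<in>?A. lookup (midx_deriv \<gamma> p) (\<delta> - \<gamma>) *
      (\<Prod>i\<in>UNIV. (a $ i) ^ lookup (\<delta> - \<gamma>) i))"
    by (subst rpoly_eval_superset[OF _ keys]) (simp_all add: sum.reindex[OF inj])
  also have "\<dots> = (\<Sum>\<delta>\<in>?A. midx_fact \<gamma> * (lookup p \<delta> *
      (\<Prod>i\<in>UNIV. real (lookup \<delta> i choose lookup \<gamma> i) * (a $ i) ^ (lookup \<delta> i - lookup \<gamma> i))))"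
    by (intro sum.cong refl)
      (auto simp: lookup_midx_deriv diff_add midx_le_def lookup_minus poch midx_fact_def prod.distrib)
  also have "\<dots> = (\<Sum>\<delta>\<in>keys p. midx_fact \<gamma> * (lookup p \<delta> *
      (\<Prod>i\<in>UNIV. real (lookup \<delta> i choose lookup \<gamma> i) * (a $ i) ^ (lookup \<delta> i - lookup \<gamma> i))))"
    by (rule sum.mono_neutral_left) (auto simp: midx_le_def not_le intro: binomial_eq_0)
  finally show ?thesis
    by (simp add: sum_distrib_left)
qed

section \<open>Translation by binomial expansion, and Taylor's formula\<close>

definition translate :: "real ^ 'n \<Rightarrow> 'n::finite rpoly \<Rightarrow> 'n rpoly" where
  "translate a p = (\<Sum>\<delta>\<in>keys p. \<Sum>\<gamma> | \<gamma> \<unlhd> \<delta>. Poly_Mapping.single \<gamma> (lookup p \<delta> *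
     (\<Prod>i\<in>UNIV. real (lookup \<delta> i choose lookup \<gamma> i) * (a $ i) ^ (lookup \<delta> i - lookup \<gamma> i))))"

text \<open>Taylor's formula: the binomials that define \<open>translate\<close> are those of
  \<open>rpoly_eval_midx_deriv\<close>, where \<gamma>! is factored out.\<close>

lemma lookup_translate:
  "lookup (translate a p) \<gamma> = rpoly_eval (midx_deriv \<gamma> p) a / midx_fact \<gamma>"
proof -
  have "(\<Prod>i\<in>UNIV. real (lookup \<delta> i choose lookup \<gamma> i) * (a $ i) ^ (lookup \<delta> i - lookup \<gamma> i)) = 0"
    if "\<not> \<gamma> \<unlhd> \<delta>" for \<delta>
    using that by (auto simp: midx_le_def not_le intro: binomial_eq_0)
  then show ?thesis
    using midx_fact_pos[of \<gamma>]
    by (auto simp: translate_def rpoly_eval_midx_deriv lookup_sum lookup_single when_def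
      finite_midx_le intro!: sum.cong)
qed

text \<open>Choosing \<gamma> \<unlhd> \<delta> means choosing one exponent per variable
  independently, so this is distributivity. It reduces the multivariate binomial theorem to the
  univariate one.\<close>

lemma sum_midx_le_prod:
  fixes f :: "'n::finite \<Rightarrow> nat \<Rightarrow> 'b::comm_semiring_1"
  shows "(\<Sum>\<gamma> | \<gamma> \<unlhd> \<delta>. \<Prod>i\<in>UNIV. f i (lookup \<gamma> i)) = (\<Prod>i\<in>UNIV. \<Sum>k\<le>lookup \<delta> i. f i k)"
proof -
  have "bij_betw lookup {\<gamma>. \<gamma> \<unlhd> \<delta>} (\<Pi>\<^sub>E i\<in>UNIV. {..lookup \<delta> i})"
    by (rule bij_betw_byWitness[of _ Abs_poly_mapping])
      (auto simp: midx_le_def PiE_iff lookup_inverse)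
  then have "(\<Sum>\<gamma> | \<gamma> \<unlhd> \<delta>. \<Prod>i\<in>UNIV. f i (lookup \<gamma> i)) =
      (\<Sum>g\<in>(\<Pi>\<^sub>E i\<in>UNIV. {..lookup \<delta> i}). \<Prod>i\<in>UNIV. f i (g i))"
    by (rule sum.reindex_bij_betw)
  then show ?thesis
    by (simp add: prod_sum_PiE)
qed

lemma rpoly_eval_translate: "rpoly_eval (translate a p) x = rpoly_eval p (x + a)"
proof -
  have "rpoly_eval (translate a p) x = (\<Sum>\<delta>\<in>keys p. lookup p \<delta> *
      (\<Sum>\<gamma> | \<gamma> \<unlhd> \<delta>. \<Prod>i\<in>UNIV. real (lookup \<delta> i choose lookup \<gamma> i) *
        (x $ i) ^ lookup \<gamma> i * (a $ i) ^ (lookup \<delta> i - lookup \<gamma> i)))"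
    by (simp add: translate_def rpoly_eval_sum rpoly_eval_single sum_distrib_left prod.distrib ac_simps)
  also have "\<dots> = (\<Sum>\<delta>\<in>keys p. lookup p \<delta> * (\<Prod>i\<in>UNIV. (x $ i + a $ i) ^ lookup \<delta> i))"
    by (simp add: binomial_ring
      sum_midx_le_prod[where f = "\<lambda>i k. real (lookup _ i choose k) * (x $ i) ^ k * (a $ i) ^ (lookup _ i - k)"])
  finally show ?thesis
    by (simp add: rpoly_eval_def)
qed

lemma midx_deriv_midx_deriv: "midx_deriv \<gamma> (midx_deriv \<beta> p) = midx_deriv (\<gamma> + \<beta>) p"
  by (rule poly_mapping_eqI)
    (simp add: lookup_midx_deriv lookup_add pochhammer_product' prod.distrib, simp add: ac_simps)

lemma midx_fact_add:
  "midx_fact (\<gamma> + \<beta>) =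
     midx_fact \<gamma> * (\<Prod>i\<in>UNIV. pochhammer (real (lookup \<gamma> i) + 1) (lookup \<beta> i))"
  by (simp add: midx_fact_def lookup_add pochhammer_fact pochhammer_product' prod.distrib)
    (simp add: ac_simps)

text \<open>By Taylor's formula, both coefficients at \<gamma> are the derivative of order \<gamma>
  + \<beta> at a, divided by \<gamma>!. On the left, the Pochhammer product is
  (\<gamma>+\<beta>)!/\<gamma>! and cancels against (\<gamma>+\<beta>)!.\<close>

lemma midx_deriv_translate: "midx_deriv \<beta> (translate a p) = translate a (midx_deriv \<beta> p)"
proof (rule poly_mapping_eqI)
  fix \<gamma>
  have "(\<Prod>i\<in>UNIV. pochhammer (real (lookup \<gamma> i) + 1) (lookup \<beta> i)) \<noteq> 0"
    using midx_fact_pos[of "\<gamma> + \<beta>"] unfolding midx_fact_add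
    by (metis less_irrefl mult_zero_right)
  then show "lookup (midx_deriv \<beta> (translate a p)) \<gamma> = lookup (translate a (midx_deriv \<beta> p)) \<gamma>"
    by (simp add: lookup_midx_deriv[of \<beta>] lookup_translate midx_deriv_midx_deriv midx_fact_add)
qed

text \<open>A nonzero Taylor coefficient at \<gamma> needs a monomial \<beta> + \<gamma> in p, so no
  partial degree grows.\<close>

lemma translate_in_rpoly_space:
  assumes "p \<in> rpoly_space \<mu>"
  shows "translate a p \<in> rpoly_space \<mu>"
  unfolding rpoly_space_iff
proof
  fix \<gamma> assume "\<gamma> \<in> keys (translate a p)"
  then have "midx_deriv \<gamma> p \<noteq> 0"
    by (auto simp: in_keys_iff lookup_translate)
  then obtain \<beta> where "lookup (midx_deriv \<gamma> p) \<beta> \<noteq> 0"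
    by (metis lookup_zero poly_mapping_eqI)
  then have "\<beta> + \<gamma> \<in> keys p"
    by (auto simp: lookup_midx_deriv in_keys_iff)
  then have "\<beta> + \<gamma> \<unlhd> \<mu>"
    using assms by (auto simp: rpoly_space_iff)
  then show "\<gamma> \<unlhd> \<mu>"
    by (auto simp: midx_le_def lookup_add intro: add_leD2)
qed

lemma translate_0: "translate 0 p = p" for p :: "'n::finite rpoly"
proof (rule poly_mapping_eqI)
  fix \<gamma> :: "'n midx"
  have "rpoly_eval q 0 = lookup q 0" for q :: "'n rpoly"
  proof -
    \<comment> \<open>As 0^0 = 1, only the constant monomial survives at the origin.\<close>
    have monom: "(\<Prod>i\<in>UNIV. (0::real) ^ lookup \<beta> i) = (if \<beta> = 0 then 1 else 0)" for \<beta> :: "'n midx"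
      by (auto simp: poly_mapping_eq_iff fun_eq_iff)
    show ?thesis
      by (simp add: rpoly_eval_def monom in_keys_iff if_distrib cong: if_cong)
  qed
  moreover have "(\<Prod>i\<in>UNIV. pochhammer 1 (lookup \<gamma> i)) = midx_fact \<gamma>"
    by (simp add: midx_fact_def pochhammer_fact)
  ultimately show "lookup (translate 0 p) \<gamma> = lookup p \<gamma>"
    using midx_fact_pos[of \<gamma>] by (simp add: lookup_translate lookup_midx_deriv)
qed

section \<open>Operators with frozen coefficients and the Fischer-Fock product\<close>

lemma rpoly_eval_operator_at:
  "rpoly_eval (operator_at \<mu> T y f) x =
     (\<Sum>\<beta> | \<beta> \<unlhd> \<mu>. rpoly_eval (operator_coeff \<mu> T \<beta>) y * rpoly_eval (midx_deriv \<beta> f) x)"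
  by (simp add: operator_at_def rpoly_eval_sum rpoly_eval_scaleR)

text \<open>The coefficients are frozen at y and do not move with x, so the operator commutes with
  translations.\<close>

lemma rpoly_eval_operator_at_translate:
  "rpoly_eval (operator_at \<mu> T y (translate a f)) x = rpoly_eval (operator_at \<mu> T y f) (x + a)"
  by (simp add: rpoly_eval_operator_at midx_deriv_translate rpoly_eval_translate)

lemma fischer_inner_symbol_at:
  "fischer_inner (symbol_at \<mu> T y) g =
     (\<Sum>\<beta> | \<beta> \<unlhd> \<mu>. midx_fact \<beta> * rpoly_eval (operator_coeff \<mu> T \<beta>) y * lookup g \<beta>)"
proof -
  have lk: "lookup (symbol_at \<mu> T y) \<beta> =
      (if \<beta> \<unlhd> \<mu> then rpoly_eval (operator_coeff \<mu> T \<beta>) y else 0)" for \<beta>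
    by (simp add: symbol_at_def lookup_sum lookup_single when_def finite_midx_le)
  \<comment> \<open>The sum passes through a common superset: coefficients may vanish at y, and g
    may have keys not below \<mu>.\<close>
  have "fischer_inner (symbol_at \<mu> T y) g =
      (\<Sum>\<beta> \<in> {\<beta>. \<beta> \<unlhd> \<mu>} \<union> (keys (symbol_at \<mu> T y) \<union> keys g).
         midx_fact \<beta> * lookup (symbol_at \<mu> T y) \<beta> * lookup g \<beta>)"
    unfolding fischer_inner_def
    by (rule sum.mono_neutral_left) (auto simp: finite_midx_le in_keys_iff)
  also have "\<dots> = (\<Sum>\<beta> | \<beta> \<unlhd> \<mu>. midx_fact \<beta> * lookup (symbol_at \<mu> T y) \<beta> * lookup g \<beta>)"
    by (rule sum.mono_neutral_right) (auto simp: finite_midx_le lk)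
  finally show ?thesis
    by (simp add: lk)
qed

text \<open>The weight \<beta>! of the Fischer-Fock product cancels the 1/\<beta>! of the Taylor
  coefficients.\<close>

lemma rpoly_eval_operator_at_eq_fischer_inner:
  "rpoly_eval (operator_at \<mu> T y f) x = fischer_inner (symbol_at \<mu> T y) (translate x f)"
  by (simp add: rpoly_eval_operator_at fischer_inner_symbol_at lookup_translate
    midx_fact_pos[THEN less_imp_neq, symmetric])

text \<open>Evaluation is multiplicative, so evaluating the differential form of T f at y freezes
  its coefficients at y.\<close>

lemma rpoly_eval_operator_at_diagonal:
  assumes "linear_operator_on (rpoly_space \<mu>) T" "f \<in> rpoly_space \<mu>"
  shows "rpoly_eval (T f) y = rpoly_eval (operator_at \<mu> T y f) y"
proof -
  have "represents_operator \<mu> T (operator_coeff \<mu> T)"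
    unfolding operator_coeff_def by (rule theI'[OF represents_operator_ex1[OF assms(1)]])
  then have "T f = (\<Sum>\<beta> | \<beta> \<unlhd> \<mu>. operator_coeff \<mu> T \<beta> * midx_deriv \<beta> f)"
    using assms(2) by (simp add: represents_operator_def)
  then show ?thesis
    by (simp add: rpoly_eval_operator_at rpoly_eval_sum rpoly_eval_mult)
qed

text \<open>The predicate P stands for nonnegativity or positivity, so one argument serves both
  cones. The conditions are linked in the cycle \<open>?L\<close>, \<open>?At\<close>,
  \<open>?T\<close>, \<open>?L\<close>.\<close>

lemma preserver_iff_fischer_inner:
  fixes T :: "'n::finite rpoly \<Rightarrow> 'n rpoly"
  assumes lin: "linear_operator_on (rpoly_space \<mu>) T"
    and K: "K = {p. \<forall>x. P (rpoly_eval p x)}"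
  shows operator_at_preserver_iff: "(\<forall>y. operator_at \<mu> T y ` (K \<inter> rpoly_space \<mu>) \<subseteq> K) \<longleftrightarrow>
      (\<forall>y. \<forall>f\<in>K \<inter> rpoly_space \<mu>. P (fischer_inner (symbol_at \<mu> T y) f))" (is "?At \<longleftrightarrow> ?L")
    and operator_preserver_iff: "T ` (K \<inter> rpoly_space \<mu>) \<subseteq> K \<longleftrightarrow>
      (\<forall>y. operator_at \<mu> T y ` (K \<inter> rpoly_space \<mu>) \<subseteq> K)" (is "?T \<longleftrightarrow> _")
proof -
  have translate_in: "translate a f \<in> K \<inter> rpoly_space \<mu>" if "f \<in> K \<inter> rpoly_space \<mu>" for a f
    using that by (auto simp: K rpoly_eval_translate translate_in_rpoly_space)
  have L_At: ?At if ?L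
    using that translate_in by (auto simp: K rpoly_eval_operator_at_eq_fischer_inner)
  have At_T: ?T if ?At
    using that by (fastforce simp: K rpoly_eval_operator_at_diagonal[OF lin])
  have T_L: ?L if T: ?T
  proof (intro allI ballI)
    fix y f assume f: "f \<in> K \<inter> rpoly_space \<mu>"
    \<comment> \<open>The operators T and \<open>operator_at \<mu> T y\<close> are known to agree
      only at the point y. Shifting f by -y turns evaluation there into evaluation at the origin for
      f itself, which is the pairing with the symbol.\<close>
    have "P (rpoly_eval (T (translate (- y) f)) y)"
      using T translate_in[OF f, of "- y"] by (auto simp: K)
    moreover have "rpoly_eval (T (translate (- y) f)) y = fischer_inner (symbol_at \<mu> T y) f"
      using translate_in[OF f, of "- y"]
      by (simp add: rpoly_eval_operator_at_diagonal[OF lin] rpoly_eval_operator_at_translate)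
        (simp add: rpoly_eval_operator_at_eq_fischer_inner translate_0)
    ultimately show "P (fischer_inner (symbol_at \<mu> T y) f)" by simp
  qed
  show "?At \<longleftrightarrow> ?L" "?T \<longleftrightarrow> ?At"
    using L_At At_T T_L by blast+
qed

theorem mainTheorem7:
  fixes \<alpha> :: "'n::finite midx" and T :: "'n rpoly \<Rightarrow> 'n rpoly"
  assumes "linear_operator_on (rpoly_space (\<alpha> + \<alpha>)) T"
  shows
    "(T ` (POS_bar \<inter> rpoly_space (\<alpha> + \<alpha>)) \<subseteq> POS_bar \<longleftrightarrow>
        (\<forall>y. operator_at (\<alpha> + \<alpha>) T y ` (POS_bar \<inter> rpoly_space (\<alpha> + \<alpha>)) \<subseteq> POS_bar)) \<and>
     ((\<forall>y. operator_at (\<alpha> + \<alpha>) T y ` (POS_bar \<inter> rpoly_space (\<alpha> + \<alpha>)) \<subseteq> POS_bar) \<longleftrightarrow>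
        (\<forall>y. \<forall>f \<in> POS_bar \<inter> rpoly_space (\<alpha> + \<alpha>).
           fischer_inner (symbol_at (\<alpha> + \<alpha>) T y) f \<ge> 0)) \<and>
     ((\<forall>y. \<forall>f \<in> POS_bar \<inter> rpoly_space (\<alpha> + \<alpha>).
           fischer_inner (symbol_at (\<alpha> + \<alpha>) T y) f \<ge> 0) \<longleftrightarrow>
        (\<forall>y. symbol_at (\<alpha> + \<alpha>) T y \<in> dual_cone (POS_bar \<inter> rpoly_space (\<alpha> + \<alpha>)))) \<and>
     (T ` (POS \<inter> rpoly_space (\<alpha> + \<alpha>)) \<subseteq> POS \<longleftrightarrow>
        (\<forall>y. operator_at (\<alpha> + \<alpha>) T y ` (POS \<inter> rpoly_space (\<alpha> + \<alpha>)) \<subseteq> POS)) \<and>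
     ((\<forall>y. operator_at (\<alpha> + \<alpha>) T y ` (POS \<inter> rpoly_space (\<alpha> + \<alpha>)) \<subseteq> POS) \<longleftrightarrow>
        (\<forall>y. \<forall>f \<in> POS \<inter> rpoly_space (\<alpha> + \<alpha>).
           fischer_inner (symbol_at (\<alpha> + \<alpha>) T y) f > 0))"
proof -
  \<comment> \<open>Each definition, used as the second premise, instantiates both K and P.\<close>
  note bar = assms POS_bar_def
  note pos = assms POS_def
  show ?thesis
    by (intro conjI operator_preserver_iff[OF bar] operator_at_preserver_iff[OF bar]
      operator_preserver_iff[OF pos] operator_at_preserver_iff[OF pos])
      (auto simp: dual_cone_def)
qed

end
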